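(* Suppose the smoothness assumption, the sampling assumption and the strong convexity assumption (with parameter $\sigma_Z>0$) stated in the context hold. Then the sequence generated by the random sketch descent (RSD) algorithm satisfies, for every $k\ge0$, $$\mathbf{E}[f(x^k)]-f^*\;\le\;(1-\sigma_Z)^k\,\big(f(x^0)-f^*\big).$$
   Context: Problem: $f^*=\min_{x\in\mathbb{R}^n} f(x)$ subject to $Ax=b$, where $f:\mathbb{R}^n\to\mathbb{R}$ is differentiable, $A\in\mathbb{R}^{m\times n}$ with $m<n$ (the paper: $m\ll n$), and the feasible set is nonempty. A point $x^0$ with $Ax^0=b$ is fixed; the feasible set is $x^0+\ker(A)$. Smoothness assumption: there is a symmetric positive semidefinite matrix $M\in\mathbb{R}^{n\times n}$, positive definite on $\ker(A)$ (i.e. $u^TMu>0$ for all nonzero $u\in\ker(A)$), such that $f(y)\le f(x)+\langle\nabla f(x),y-x\rangle+\tfrac12 (y-x)^TM(y-x)$ for all $x,y\in x^0+\ker(A)$. Sketching: $\mathcal{S}$ is a probability distribution on matrices $S\in\mathbb{R}^{n\times p}$ ($p$ may itself be random). $B^\dagger$ denotes the Moore–Penrose pseudo-inverse of $B$. Put $P_S=I_p-(AS)^\dagger(AS)$, $Z_S=SP_S(P_S^TS^TMSP_S)^\dagger P_S^TS^T\in\mathbb{R}^{n\times n}$, and $Z=\mathbf{E}_{S\sim\mathcal{S}}[Z_S]$. Sampling assumption: $Z_S$ has finite mean, and $Z$ is positive definite on $\ker(A)$. Norms: $\|u\|_Z=\sqrt{u^TZu}$ for $u\in\mathbb{R}^n$;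 for $x\in\ker(A)$, $\|x\|_Z^*=\max_{u\in\mathbb{R}^n:\|u\|_Z\le1}\langle x,u\rangle=\sqrt{x^TZ^\dagger x}$. Strong convexity assumption: there is $\sigma_Z>0$ with $f(x)\ge f(y)+\langle\nabla f(y),x-y\rangle+\tfrac{\sigma_Z}{2}(\|x-y\|_Z^* )^2$ for all $x,y\in x^0+\ker(A)$. RSD algorithm: starting at the feasible $x^0$, at each iteration $k\ge0$ sample $S\sim\mathcal{S}$ (independently of the past) and set $x^{k+1}=x^k-Z_S\nabla f(x^k)$. $\mathbf{E}$ is the expectation over all sampled sketch matrices. *)

theory Defs
  imports "HOL-Probability.Probability" "Jordan_Normal_Form.Matrix"
begin

no_notation vec_index (infixl "$" 100)

text \<open>
  The problem data live in the fixed-dimension types of HOL-Analysis, whereas a sketch matrix has a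
  number of columns that may vary with the sample, so it is a dimension-carrying matrix of type
  \<^typ>\<open>real mat\<close>. Rows and columns are identified through the fixed enumeration
  \<^term>\<open>from_nat_into (UNIV :: 'n::finite set)\<close>, a bijection from
  \<open>{..<CARD('n)}\<close> onto the index type, with inverse \<^term>\<open>to_nat_on (UNIV :: 'n::finite set)\<close>.
\<close>

definition to_mat :: "real^'c^'r \<Rightarrow> real mat" where
  "to_mat B = Matrix.mat CARD('r) CARD('c)
     (\<lambda>(i, j). B $ from_nat_into UNIV i $ from_nat_into UNIV j)"

definition of_mat :: "real mat \<Rightarrow> real^'c^'r" where
  "of_mat B = (\<chi> i j. B $$ (to_nat_on UNIV i, to_nat_on UNIV j))"

lemma to_nat_on_less_card: "to_nat_on UNIV (i :: 'd::finite) < CARD('d)"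
  using to_nat_on_finite[of "UNIV :: 'd set"] by (auto simp: bij_betw_def)

lemma of_mat_to_mat: "of_mat (to_mat B) = (B :: real^'c^'r)"
  by (simp add: of_mat_def to_mat_def vec_eq_iff countable_finite to_nat_on_less_card)

text \<open>Moore--Penrose pseudo-inverse, characterised by the four Penrose equations.\<close>

definition is_pinv :: "real mat \<Rightarrow> real mat \<Rightarrow> bool" where
  "is_pinv B X \<longleftrightarrow> X \<in> carrier_mat (dim_col B) (dim_row B) \<and>
     B * X * B = B \<and> X * B * X = X \<and>
     transpose_mat (B * X) = B * X \<and> transpose_mat (X * B) = X * B"

definition pinv :: "real mat \<Rightarrow> real mat" where
  "pinv B = (THE X. is_pinv B X)"

lemma is_pinv_unique:
  assumes "is_pinv B X" "is_pinv B Y"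
  shows "X = Y"
proof -
  obtain m n where B: "B \<in> carrier_mat m n" by blast
  have X: "X \<in> carrier_mat n m" and Y: "Y \<in> carrier_mat n m"
    and x: "B * X * B = B" "X * B * X = X" "(B * X)\<^sup>T = B * X" "(X * B)\<^sup>T = X * B"
    and y: "B * Y * B = B" "Y * B * Y = Y" "(B * Y)\<^sup>T = B * Y" "(Y * B)\<^sup>T = Y * B"
    using assms B by (auto simp: is_pinv_def)
  have BX: "B * X \<in> carrier_mat m m" and BY: "B * Y \<in> carrier_mat m m"
    and XB: "X * B \<in> carrier_mat n n" and YB: "Y * B \<in> carrier_mat n n"
    by (simp_all add: mult_carrier_mat[OF B X] mult_carrier_mat[OF B Y]
        mult_carrier_mat[OF X B] mult_carrier_mat[OF Y B])
  have 1: "B * X = B * Y"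
  proof -
    have "B * X = (B * Y * B * X)\<^sup>T" using x y by simp
    also have "\<dots> = ((B * Y) * (B * X))\<^sup>T" using B X BY by (metis assoc_mult_mat)
    also have "\<dots> = (B * X) * (B * Y)" using BX BY x y by (metis transpose_mult)
    also have "\<dots> = B * X * B * Y" using BX B Y by (metis assoc_mult_mat)
    finally show ?thesis using x by simp
  qed
  have 2: "X * B = Y * B"
  proof -
    have "X * B = (X * (B * Y * B))\<^sup>T" using x y by simp
    also have "\<dots> = ((X * B) * (Y * B))\<^sup>T" using X B Y YB by (metis assoc_mult_mat)
    also have "\<dots> = (Y * B) * (X * B)" using XB YB x y by (metis transpose_mult)
    also have "\<dots> = Y * (B * X * B)" using Y B X XB by (metis assoc_mult_mat)
    finally show ?thesis using x by simp
  qed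
  have "X = X * B * Y" using 1 x X B Y by (metis assoc_mult_mat)
  then show ?thesis using 2 y by simp
qed

definition sketch_proj :: "real^'n^'m \<Rightarrow> real mat \<Rightarrow> real mat" where
  "sketch_proj A S = 1\<^sub>m (dim_col S) - pinv (to_mat A * S) * (to_mat A * S)"

definition sketch_update :: "real^'n^'m \<Rightarrow> real^'n^'n \<Rightarrow> real mat \<Rightarrow> real^'n^'n" where
  "sketch_update A M S =
     (let P = sketch_proj A S in
      of_mat (S * P * pinv (transpose_mat P * transpose_mat S * to_mat M * S * P)
                * transpose_mat P * transpose_mat S))"

definition ker :: "real^'n^'m \<Rightarrow> (real^'n) set" where
  "ker A = {u. A *v u = 0}"

definition qnorm :: "real^'n^'n \<Rightarrow> real^'n \<Rightarrow> real" where
  "qnorm Z u = sqrt (u \<bullet> (Z *v u))"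

text \<open>
  The dual norm is used only on \<^term>\<open>ker A\<close> for \<open>Z\<close> positive semidefinite, positive definite
  on \<^term>\<open>ker A\<close> and with range in \<^term>\<open>ker A\<close>; there the supremum is finite and attained, and equals \<open>sqrt (x\<^sup>T Z\<^sup>\<dagger> x)\<close>.
\<close>

definition dual_qnorm :: "real^'n^'n \<Rightarrow> real^'n \<Rightarrow> real" where
  "dual_qnorm Z x = (SUP u\<in>{u. qnorm Z u \<le> 1}. x \<bullet> u)"

text \<open>The iterates along one realisation \<open>S 0, S 1, \<dots>\<close> of the sampled sketch matrices;
  \<open>g\<close> is the gradient of the objective.\<close>

primrec rsd ::
  "real^'n^'m \<Rightarrow> real^'n^'n \<Rightarrow> (real^'n \<Rightarrow> real^'n) \<Rightarrow> real^'n \<Rightarrow> (nat \<Rightarrow> real mat) \<Rightarrow> nat \<Rightarrow> real^'n"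
where
  "rsd A M g x0 S 0 = x0"
| "rsd A M g x0 S (Suc k) =
     rsd A M g x0 S k - sketch_update A M (S k) *v g (rsd A M g x0 S k)"

text \<open>
  A distribution of sketch matrices with \<open>n\<close> rows and a random number of columns. Its
  \<open>\<sigma>\<close>-algebra is left arbitrary (the Borel one is an instance); measurability of
  \<^term>\<open>sketch_update A M\<close> is part of the integrability assumed of it.
\<close>

definition sketch_distribution :: "nat \<Rightarrow> real mat measure \<Rightarrow> bool" where
  "sketch_distribution n \<D> \<longleftrightarrow> prob_space \<D> \<and> space \<D> \<subseteq> {S. dim_row S = n}"

definition iid_samples :: "'w measure \<Rightarrow> 'a measure \<Rightarrow> (nat \<Rightarrow> 'w \<Rightarrow> 'a) \<Rightarrow> bool" where
  "iid_samples \<P> \<D> S \<longleftrightarrow> prob_space \<P> \<and>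
     prob_space.indep_vars \<P> (\<lambda>_. \<D>) S UNIV \<and> (\<forall>k. distr \<P> \<D> (S k) = \<D>)"

text \<open>
  The optimal value of minimising \<open>f\<close> subject to \<open>A x = b\<close>. Under strong convexity with
  respect to a dual norm as above, the infimum is an attained minimum.
\<close>

definition opt_value :: "(real^'n \<Rightarrow> real) \<Rightarrow> real^'n^'m \<Rightarrow> real^'m \<Rightarrow> real" where
  "opt_value f A b = (INF x\<in>{x. A *v x = b}. f x)"

end

theory Submission
  imports Defs "Jordan_Normal_Form.Gauss_Jordan_Elimination"
begin

(* Both symbols denote the operations on Euclidean vectors below. *)
no_notation vec_index (infixl "$" 100)
no_notation scalar_prod (infix "\<bullet>" 70)

text \<open>
For a sketch \<open>S\<close> the update matrix \<open>W = Z\<^sub>S\<close> is symmetric, has its range in the kernel of \<open>A\<close>, and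
satisfies \<open>W M W = W\<close>; all three facts follow from the Penrose equations
(\<open>sketch_update_properties\<close>). Hence a step \<open>-W g\<close> with \<open>g = grad x\<close> keeps the iterate feasible,
and the quadratic term of the smoothness bound is half the size of the linear one:
\<open>f (x - W g) \<le> f x - g \<bullet> W g / 2\<close> (\<open>sketch_step_descent\<close>). Averaging over \<open>S\<close> replaces \<open>W\<close> by \<open>Z\<close>,
so the expected decrease is at least half of \<open>g \<bullet> Z g\<close>.

Strong convexity makes the gradient large whenever the optimality gap is. As \<open>Z\<close> is symmetric with
range in the kernel and positive definite there, every difference of feasible points is of the form
\<open>Z w\<close>, and its squared dual norm is at least \<open>w \<bullet> Z w\<close>. Completing the square in \<open>w\<close> turns strong
convexity into \<open>\<sigma> (f x - f\<^sup>*) \<le> g \<bullet> Z g / 2\<close> (\<open>gradient_dominated\<close>). Together, one step multiplies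
the expected gap by at most \<open>1 - \<sigma>\<close>.

The expectation can be taken over the fresh sample first because the iterate \<open>x\<^sup>k\<close> depends only on
the earlier samples, so the joint law of \<open>x\<^sup>k\<close> and \<open>S\<^sub>k\<close> is a product and Fubini's theorem applies
(\<open>integral_over_fresh_sample\<close>). The integrands are bounded, since along every realisation the
values of \<open>f\<close> stay between \<open>f\<^sup>*\<close> and \<open>f x\<^sup>0\<close>.
\<close>

section \<open>Existence of the Moore--Penrose inverse\<close>

text \<open>
Associativity guarded by equations between dimensions, not by membership in a carrier set: the
guards are then discharged by simplification, and products can be normalised by rewriting.
\<close>
lemma mat_mult_assoc:
  fixes X Y W :: "real mat"
  assumes "dim_col X = dim_row Y" "dim_col Y = dim_row W"
  shows "X * Y * W = X * (Y * W)"
  using assms by (intro assoc_mult_mat) (auto intro!: carrier_matI)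

lemma mat_transpose_mult:
  fixes X Y :: "real mat"
  assumes "dim_col X = dim_row Y"
  shows "transpose_mat (X * Y) = transpose_mat Y * transpose_mat X"
  using assms by (intro transpose_mult) (auto intro!: carrier_matI)

lemma mat_gram_eq_0:
  fixes B :: "real mat"
  assumes "transpose_mat B * B = 0\<^sub>m (dim_col B) (dim_col B)"
  shows "B = 0\<^sub>m (dim_row B) (dim_col B)"
proof (rule eq_matI)
  fix i j assume ij: "i < dim_row (0\<^sub>m (dim_row B) (dim_col B) :: real mat)" "j < dim_col (0\<^sub>m (dim_row B) (dim_col B) :: real mat)"
  have "(transpose_mat B * B) $$ (j, j) = 0" using assms ij by simp
  then have "(\<Sum>l<dim_row B. (B $$ (l, j))\<^sup>2) = 0"
    using ij by (simp add: scalar_prod_def power2_eq_square atLeast0LessThan)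
  then show "B $$ (i, j) = 0\<^sub>m (dim_row B) (dim_col B) $$ (i, j)"
    using ij by (subst (asm) sum_nonneg_eq_0_iff) auto
qed auto

text \<open>
The matrix \<open>D = B X - B\<close> satisfies \<open>B\<^sup>T D = 0\<close>, hence \<open>D\<^sup>T D = 0\<close>, and over the reals this forces \<open>D = 0\<close>.
\<close>
lemma mat_gram_cancel:
  fixes B X :: "real mat"
  assumes dims: "dim_col B = dim_row X" "dim_col X = dim_col B"
    and eq: "transpose_mat B * (B * X) = transpose_mat B * B"
  shows "B * X = B"
proof -
  let ?D = "B * X - B"
  obtain m n where B: "B \<in> carrier_mat m n" by blast
  have X: "X \<in> carrier_mat n n" using B dims by (auto intro!: carrier_matI)
  have Bt: "transpose_mat B \<in> carrier_mat n m" using B by simp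
  have Xt: "transpose_mat X \<in> carrier_mat n n" using X by simp
  have BX: "B * X \<in> carrier_mat m n" using B X by simp
  have 0: "transpose_mat B * ?D = 0\<^sub>m n n"
    using eq mult_minus_distrib_mat[OF Bt BX B] B Bt by (auto intro!: minus_r_inv_mat)
  have D: "?D \<in> carrier_mat m n" using minus_carrier_mat[OF B] .
  have "transpose_mat ?D * ?D = transpose_mat X * (transpose_mat B * ?D) - transpose_mat B * ?D"
    using B X D Bt Xt BX by (simp add: transpose_minus[OF BX B] minus_mult_distrib_mat[of _ n m _ _ n] mat_transpose_mult mat_mult_assoc)
  also have "\<dots> = 0\<^sub>m n n" using Xt by (simp add: 0)
  finally have "?D = 0\<^sub>m m n" using mat_gram_eq_0[of ?D] carrier_matD[OF B] by simp
  then have "B * X - B + B = B" using B by simp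
  moreover have "B * X - B + B = B * X"
    by (rule eq_matI) (use B X in auto)
  ultimately show ?thesis by simp
qed

text \<open>
An inverse in the weak sense \<open>C G C = C\<close> is read off from the reduced row echelon form \<open>E\<close> of \<open>C\<close>:
sending each pivot row to its pivot column gives a matrix \<open>R\<close> with \<open>E R E = E\<close>, and the row
operations \<open>P\<close> that lead from \<open>C\<close> to \<open>E\<close> carry it over to \<open>G = R P\<close>.
\<close>
lemma mat_generalized_inverse_exists:
  fixes C :: "real mat"
  obtains G where "dim_row G = dim_col C" "dim_col G = dim_row C" "C * (G * C) = C"
proof -
  obtain m n where C: "C \<in> carrier_mat m n" by blast
  define E where "E = gauss_jordan_single C"
  note gj = gauss_jordan_single[OF C E_def[symmetric]]
  obtain P Q where PQ: "E = P * C" "P \<in> carrier_mat m m" "Q \<in> carrier_mat m m" "Q * P = 1\<^sub>m m"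
    using gj(4) by blast
  have E: "E \<in> carrier_mat m n" by (rule gj(2))
  obtain p where p: "pivot_fun E p n" using gj(3) E by (auto simp: row_echelon_form_def)
  have dimE: "dim_row E = m" using E by simp
  note pv = pivot_funD[OF dimE p]
  define R :: "real mat" where "R = Matrix.mat n m (\<lambda>(j, i). if j = p i then 1 else 0)"
  have R: "R \<in> carrier_mat n m" by (simp add: R_def)
  \<comment> \<open>In a zero row the pivot function has the value \<open>n\<close>, so that \<open>E R\<close> is the diagonal projection onto the indices of the nonzero rows of \<open>E\<close>.\<close>
  have ER: "(E * R) $$ (i', i) = (if i' = i \<and> p i < n then 1 else 0)" if i: "i' < m" "i < m" for i' i
  proof -
    have "(E * R) $$ (i', i) = (\<Sum>j<n. E $$ (i', j) * (if j = p i then 1 else 0))"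
      using E R i by (simp add: scalar_prod_def R_def atLeast0LessThan)
    also have "\<dots> = (if p i < n then E $$ (i', p i) else 0)" by (simp add: if_distrib cong: if_cong)
    finally show ?thesis using pv(4)[of i] pv(5)[of i i'] i by auto
  qed
  have "E * R * E = E"
  proof (rule eq_matI)
    fix i j assume ij: "i < dim_row E" "j < dim_col E"
    then have ij': "i < m" "j < n" using E by auto
    have "(F * E) $$ (i, j) = (\<Sum>l<m. F $$ (i, l) * E $$ (l, j))"
      if "F \<in> carrier_mat m m" for F
      using E that ij' by (simp add: scalar_prod_def atLeast0LessThan)
    from this[of "E * R"]
    have "(E * R * E) $$ (i, j) = (\<Sum>l<m. (E * R) $$ (i, l) * E $$ (l, j))"
      using E R by simp
    also have "\<dots> = (\<Sum>l<m. (if l = i then (if p i < n then E $$ (l, j) else 0) else 0))"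
      by (intro sum.cong) (auto simp: ER ij')
    also have "\<dots> = E $$ (i, j)"
      using pv(1)[of i] pv(2)[of i j] ij' by (auto simp: not_less)
    finally show "(E * R * E) $$ (i, j) = E $$ (i, j)" .
  qed (use E R in auto)
  then have ERE: "E * (R * E) = E" using E R by (simp add: mat_mult_assoc)
  have QE: "Q * E = C" using PQ C by (simp add: mat_mult_assoc[symmetric])
  show thesis
  proof (rule that[of "R * P"])
    have "C * ((R * P) * C) = Q * (E * (R * E))"
      using PQ C R E by (simp add: QE[symmetric] mat_mult_assoc)
    then show "C * ((R * P) * C) = C" by (simp add: ERE QE)
  qed (use R PQ C in auto)
qed

text \<open>
With weak inverses \<open>U\<close> of \<open>B B\<^sup>T\<close> and \<open>V\<close> of \<open>B\<^sup>T B\<close>, the matrices \<open>B V B\<^sup>T\<close> and \<open>B\<^sup>T U B\<close> are the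
orthogonal projections onto the column space and the row space of \<open>B\<close>. The pseudo-inverse is
\<open>B\<^sup>T U B V B\<^sup>T\<close>.
\<close>
lemma is_pinv_exists: "\<exists>X. is_pinv (B :: real mat) X"
proof -
  let ?T = "transpose_mat B"
  obtain V where V: "dim_row V = dim_col B" "dim_col V = dim_col B"
    "(?T * B) * (V * (?T * B)) = ?T * B"
    using mat_generalized_inverse_exists[of "?T * B"] by auto
  obtain U where U: "dim_row U = dim_row B" "dim_col U = dim_row B"
    "(B * ?T) * (U * (B * ?T)) = B * ?T"
    using mat_generalized_inverse_exists[of "B * ?T"] by auto
  have BV: "B * (V * (?T * B)) = B"
    by (rule mat_gram_cancel) (use V in \<open>auto simp: mat_mult_assoc\<close>)
  have TU: "?T * (U * (B * ?T)) = ?T"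
    by (rule mat_gram_cancel) (use U in \<open>auto simp: mat_mult_assoc\<close>)
  have BV': "B * (V * (?T * (B * W))) = B * W" if "dim_row W = dim_col B" for W
    using arg_cong[OF BV, of "\<lambda>Y. Y * W"] that V by (simp add: mat_mult_assoc)
  have TU': "?T * (U * (B * (?T * W))) = ?T * W" if "dim_row W = dim_row B" for W
    using arg_cong[OF TU, of "\<lambda>Y. Y * W"] that U by (simp add: mat_mult_assoc)
  have BVt: "?T * (B * (transpose_mat V * ?T)) = ?T"
    using arg_cong[OF BV, of transpose_mat] V by (simp add: mat_transpose_mult mat_mult_assoc)
  have TUt: "B * (?T * (transpose_mat U * B)) = B"
    using arg_cong[OF TU, of transpose_mat] U by (simp add: mat_transpose_mult mat_mult_assoc)
  \<comment> \<open>These two identities state that both projections are symmetric; \<open>U\<close> and \<open>V\<close> themselves may fail to be.\<close>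
  have symK: "B * (transpose_mat V * ?T) = B * (V * ?T)"
    using BV'[of "transpose_mat V * ?T"] V by (simp add: BVt)
  have symL: "?T * (transpose_mat U * B) = ?T * (U * B)"
    using TU'[of "transpose_mat U * B"] U by (simp add: TUt)
  have BT: "B * (?T * (U * (B * W))) = B * W" if "dim_row W = dim_col B" for W
    using arg_cong[OF TUt[unfolded symL], of "\<lambda>Y. Y * W"] that U by (simp add: mat_mult_assoc)
  have "is_pinv B (?T * (U * (B * (V * ?T))))"
    unfolding is_pinv_def
    using U V by (auto intro!: carrier_matI simp: mat_mult_assoc mat_transpose_mult BV BV' TU TU' symK symL BT)
  then show ?thesis by blast
qed

lemma pinv_is_pinv: "is_pinv B (pinv B)"
  unfolding pinv_def using is_pinv_exists is_pinv_unique by (metis theI)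

lemma pinv_dim [simp]: "dim_row (pinv B) = dim_col B" "dim_col (pinv B) = dim_row B"
  using pinv_is_pinv[of B] by (auto simp: is_pinv_def)

text \<open>
The Penrose equations are invariant under transposition, so this is an instance of uniqueness.
\<close>
lemma pinv_symmetric:
  assumes "transpose_mat C = C"
  shows "transpose_mat (pinv C) = pinv C"
proof (rule is_pinv_unique[of C])
  have sq: "dim_row C = dim_col C" using arg_cong[OF assms, of dim_col] by simp
  have "C * (pinv C * C) = C" "pinv C * (C * pinv C) = pinv C"
    "transpose_mat (C * pinv C) = C * pinv C" "transpose_mat (pinv C * C) = pinv C * C"
    using pinv_is_pinv[of C] sq by (auto simp: is_pinv_def mat_mult_assoc)
  from this(3,4) this(1,2)[THEN arg_cong, of transpose_mat]
  show "is_pinv C (transpose_mat (pinv C))"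
    using sq assms unfolding is_pinv_def
    by (auto intro!: carrier_matI simp: mat_transpose_mult mat_mult_assoc)
qed (rule pinv_is_pinv)

section \<open>From dimension-carrying matrices to fixed dimensions\<close>

lemma of_mat_mult:
  assumes "dim_row X = CARD('r)" "dim_col X = CARD('k)" "dim_row Y = CARD('k)" "dim_col Y = CARD('c)"
  shows "(of_mat (X * Y) :: real^'c^'r) = (of_mat X :: real^'k^'r) ** of_mat Y"
proof -
  have "(X * Y) $$ (to_nat_on UNIV i, to_nat_on UNIV j) =
    (\<Sum>k\<in>(UNIV :: 'k set). X $$ (to_nat_on UNIV i, to_nat_on UNIV k) * Y $$ (to_nat_on UNIV k, to_nat_on UNIV j))"
    for i :: 'r and j :: 'c
  proof -
    have "(X * Y) $$ (to_nat_on UNIV i, to_nat_on UNIV j) =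
      (\<Sum>k<CARD('k). X $$ (to_nat_on UNIV i, k) * Y $$ (k, to_nat_on UNIV j))"
      using assms to_nat_on_less_card[of i] to_nat_on_less_card[of j]
      by (simp add: scalar_prod_def atLeast0LessThan)
    also have "\<dots> = (\<Sum>k\<in>(UNIV :: 'k set). X $$ (to_nat_on UNIV i, to_nat_on UNIV k) * Y $$ (to_nat_on UNIV k, to_nat_on UNIV j))"
      using to_nat_on_finite[of "UNIV :: 'k set"] by (intro sum.reindex_bij_betw[symmetric]) simp
    finally show ?thesis .
  qed
  then show ?thesis by (simp add: of_mat_def matrix_matrix_mult_def vec_eq_iff)
qed

lemma of_mat_transpose:
  assumes "dim_row X = CARD('r)" "dim_col X = CARD('c)"
  shows "(of_mat (transpose_mat X) :: real^'r^'c) = Finite_Cartesian_Product.transpose (of_mat X :: real^'c^'r)"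
  using assms by (simp add: of_mat_def Finite_Cartesian_Product.transpose_def vec_eq_iff to_nat_on_less_card)

lemma to_mat_transpose:
  "to_mat (Finite_Cartesian_Product.transpose B) = transpose_mat (to_mat B)"
  by (rule eq_matI) (auto simp: to_mat_def Finite_Cartesian_Product.transpose_def)

lemma to_mat_dim [simp]:
  "dim_row (to_mat (B :: real^'c^'r)) = CARD('r)" "dim_col (to_mat (B :: real^'c^'r)) = CARD('c)"
  by (simp_all add: to_mat_def)

lemma of_mat_0: "(of_mat (0\<^sub>m CARD('r) CARD('c)) :: real^'c^'r) = 0"
  by (simp add: of_mat_def Finite_Cartesian_Product.vec_eq_iff to_nat_on_less_card)

section \<open>The sketched update matrix\<close>

lemma sketch_proj_dim [simp]:
  "dim_row (sketch_proj A S) = dim_col S" "dim_col (sketch_proj A S) = dim_col S"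
  by (simp_all add: sketch_proj_def)

text \<open>
\<open>P\<^sub>S\<close> projects onto the kernel of \<open>A S\<close>. This is what makes the iterates stay feasible.
\<close>
lemma sketch_proj_kernel:
  fixes A :: "real^'n^'m"
  assumes S: "dim_row S = CARD('n)"
  shows "to_mat A * (S * sketch_proj A S) = 0\<^sub>m CARD('m) (dim_col S)"
proof -
  let ?B = "to_mat A * S"
  have B: "?B \<in> carrier_mat CARD('m) (dim_col S)" by (auto intro!: carrier_matI)
  have I: "1\<^sub>m (dim_col S) \<in> carrier_mat (dim_col S) (dim_col S)" by simp
  have Q: "pinv ?B * ?B \<in> carrier_mat (dim_col S) (dim_col S)" by (auto intro!: carrier_matI)
  have "?B * (pinv ?B * ?B) = ?B"
    using pinv_is_pinv[of ?B] by (simp add: is_pinv_def mat_mult_assoc[of ?B "pinv ?B" ?B])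
  then have "?B * sketch_proj A S = ?B - ?B"
    unfolding sketch_proj_def using mult_minus_distrib_mat[OF B I Q] B by simp
  also have "\<dots> = 0\<^sub>m CARD('m) (dim_col S)" using B by (rule minus_r_inv_mat)
  finally show ?thesis using S by (simp add: mat_mult_assoc)
qed

text \<open>
With \<open>N = S P\<^sub>S\<close> and \<open>C = N\<^sup>T M N\<close> the update matrix is \<open>W = N C\<^sup>\<dagger> N\<^sup>T\<close>. The three identities reflect,
in turn, that \<open>C\<^sup>\<dagger>\<close> is symmetric, that \<open>C\<^sup>\<dagger> C C\<^sup>\<dagger> = C\<^sup>\<dagger>\<close>, and that \<open>A N = 0\<close>.
\<close>
lemma sketch_update_properties:
  fixes A :: "real^'n^'m" and M :: "real^'n^'n"
  assumes S: "dim_row S = CARD('n)" and M: "Finite_Cartesian_Product.transpose M = M"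
  defines "W \<equiv> sketch_update A M S"
  shows sketch_update_symmetric: "Finite_Cartesian_Product.transpose W = W"
    and sketch_update_idempotent: "W ** M ** W = W"
    and sketch_update_range: "A ** W = 0"
proof -
  define P where "P = sketch_proj A S"
  define C where "C = transpose_mat P * transpose_mat S * to_mat M * S * P"
  define D where "D = pinv C"
  define V where "V = S * P * D * transpose_mat P * transpose_mat S"
  have W: "W = of_mat V" by (simp add: W_def V_def D_def C_def P_def sketch_update_def Let_def)
  have P [simp]: "dim_row P = dim_col S" "dim_col P = dim_col S" by (simp_all add: P_def)
  have [simp]: "dim_row D = dim_col S" "dim_col D = dim_col S" by (simp_all add: D_def C_def)
  have [simp]: "dim_row V = CARD('n)" "dim_col V = CARD('n)" by (simp_all add: V_def S)
  have M': "transpose_mat (to_mat M) = to_mat M" by (simp add: M to_mat_transpose[symmetric])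
  have "transpose_mat C = C"
    by (simp add: C_def mat_transpose_mult mat_mult_assoc S M')
  then have symD: "transpose_mat D = D" unfolding D_def by (rule pinv_symmetric)
  have "transpose_mat V = V"
    by (simp add: V_def mat_transpose_mult mat_mult_assoc S symD)
  then show "Finite_Cartesian_Product.transpose W = W"
    by (simp add: W of_mat_transpose[symmetric])
  have DCD_eq: "D * C * D = D" using pinv_is_pinv[of C] by (simp add: D_def is_pinv_def)
  have DCD: "D * (transpose_mat P * (transpose_mat S * (to_mat M * (S * (P * (D * X)))))) = D * X"
    if "dim_row X = dim_col S" for X
    using arg_cong[OF DCD_eq, of "\<lambda>Y. Y * X"] that S by (simp add: C_def mat_mult_assoc)
  have "V * to_mat M * V = V"
    by (simp add: V_def mat_mult_assoc S DCD)
  moreover have "of_mat (V * to_mat M * V) = W ** M ** W"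
    unfolding W by (simp add: of_mat_mult[where 'k='n] of_mat_to_mat)
  ultimately show "W ** M ** W = W" by (simp add: W)
  have "to_mat A * (S * (P * X)) = 0\<^sub>m CARD('m) (dim_col X)" if "dim_row X = dim_col S" for X
    using arg_cong[OF sketch_proj_kernel[OF S, of A], of "\<lambda>Y. Y * X"] that S
    by (simp add: mat_mult_assoc P_def[symmetric])
  then have "to_mat A * V = 0\<^sub>m CARD('m) CARD('n)"
    by (simp add: V_def mat_mult_assoc S)
  then show "A ** W = 0"
    using of_mat_mult[of "to_mat A" V, where 'r='m and 'k='n and 'c='n] by (simp add: W of_mat_to_mat of_mat_0)
qed

lemma symmetric_inner_matrix:
  fixes W :: "real^'n^'n"
  assumes "Finite_Cartesian_Product.transpose W = W"
  shows "(W *v u) \<bullet> v = u \<bullet> (W *v v)"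
  by (metis assms dot_lmul_matrix transpose_matrix_vector)

text \<open>
The form of \<open>M\<close> at the step \<open>W u\<close> equals the form of \<open>W\<close> at \<open>u\<close>. This gives the factor \<open>1/2\<close> in the
descent estimate, and it transfers positive semidefiniteness from \<open>M\<close> to \<open>W\<close>.
\<close>
lemma sketch_quadratic_form:
  fixes W M :: "real^'n^'n"
  assumes "Finite_Cartesian_Product.transpose W = W" "W ** M ** W = W"
  shows "(W *v u) \<bullet> (M *v (W *v u)) = u \<bullet> (W *v u)"
  using assms(2) by (simp add: symmetric_inner_matrix[OF assms(1)] matrix_vector_mul_assoc matrix_mul_assoc)

section \<open>The norm of the mean update and its dual\<close>

lemma bounded_linear_matrix_form:
  "bounded_linear (\<lambda>W :: real^'n^'m. u \<bullet> (W *v v))"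
  by (auto intro!: linear_conv_bounded_linear[THEN iffD1] linearI
      simp: matrix_vector_mult_add_rdistrib inner_add_right scaleR_matrix_vector_assoc[symmetric])

text \<open>
Properties of the random update matrices that are linear in the matrix pass to the mean through
the bilinear form.
\<close>
lemma integral_matrix_form:
  fixes F :: "'a \<Rightarrow> real^'n^'m"
  assumes "integrable D F"
  shows "(\<integral>x. u \<bullet> (F x *v v) \<partial>D) = u \<bullet> ((\<integral>x. F x \<partial>D) *v v)"
  using assms by (intro integral_bounded_linear[OF bounded_linear_matrix_form])

lemma subspace_ker: "subspace (ker A)"
  by (auto simp: ker_def subspace_def matrix_vector_right_distrib matrix_vector_mult_scaleR)

text \<open>
Positive definiteness makes \<open>Z\<close> injective on the kernel of \<open>A\<close>, which it maps to itself; comparing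
dimensions gives surjectivity.
\<close>
lemma ker_image_surjective:
  fixes Z :: "real^'n^'n" and A :: "real^'n^'m"
  assumes range: "\<And>v. Z *v v \<in> ker A"
    and pd: "\<And>u. u \<in> ker A \<Longrightarrow> u \<noteq> 0 \<Longrightarrow> 0 < u \<bullet> (Z *v u)"
  shows "(*v) Z ` ker A = ker A"
proof (rule subspace_dim_equal)
  have lin: "linear ((*v) Z)" by simp
  show "subspace ((*v) Z ` ker A)" by (intro linear_subspace_image lin subspace_ker)
  have "inj_on ((*v) Z) (ker A)"
  proof (subst linear_injective_on_subspace_0[OF lin subspace_ker], safe)
    fix u assume "u \<in> ker A" "Z *v u = 0"
    then show "u = 0" using pd[of u] by fastforce
  qed
  then have "dim ((*v) Z ` ker A) = dim (ker A)"
    using subspace_ker[of A] by (intro dim_image_eq lin) (simp add: span_eq_iff[THEN iffD2])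
  then show "dim (ker A) \<le> dim ((*v) Z ` ker A)" by simp
qed (use range subspace_ker in auto)

text \<open>
Testing the supremum with the normalised \<open>w\<close>. By the Cauchy--Schwarz inequality for \<open>Z\<close> the two sides
are in fact equal.
\<close>
lemma dual_qnorm_ge:
  fixes Z :: "real^'n^'n"
  assumes sym: "\<And>u v. (Z *v u) \<bullet> v = u \<bullet> (Z *v v)" and psd: "\<And>u. 0 \<le> u \<bullet> (Z *v u)"
  shows "w \<bullet> (Z *v w) \<le> (dual_qnorm Z (Z *v w))\<^sup>2"
proof (cases "w \<bullet> (Z *v w) = 0")
  case False
  define q where "q = qnorm Z w"
  have q2: "q\<^sup>2 = w \<bullet> (Z *v w)" using psd by (simp add: q_def qnorm_def)
  have q: "q > 0" using False psd[of w] by (simp add: q_def qnorm_def order_less_le)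
  let ?u = "(1 / q) *\<^sub>R w"
  \<comment> \<open>A crude upper bound, from \<open>(w - u) \<bullet> Z (w - u) \<ge> 0\<close>: the supremum of an unbounded set of reals would be unspecified.\<close>
  have "(Z *v w) \<bullet> u \<le> (w \<bullet> (Z *v w) + 1) / 2" if "qnorm Z u \<le> 1" for u
  proof -
    have "u \<bullet> (Z *v u) \<le> 1" using that by (simp add: qnorm_def)
    moreover have "0 \<le> (w - u) \<bullet> (Z *v (w - u))" by (rule psd)
    ultimately show ?thesis
      using sym[of w u] sym[of u w]
      by (simp add: matrix_vector_mult_diff_distrib inner_diff_left inner_diff_right inner_commute)
  qed
  then have "bdd_above ((\<lambda>u. (Z *v w) \<bullet> u) ` {u. qnorm Z u \<le> 1})" by (intro bdd_aboveI2[where M="(w \<bullet> (Z *v w) + 1) / 2"]) blast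
  moreover have "qnorm Z ?u \<le> 1"
    using q by (simp add: qnorm_def matrix_vector_mult_scaleR q2[symmetric] power2_eq_square)
  ultimately have "(Z *v w) \<bullet> ?u \<le> dual_qnorm Z (Z *v w)"
    unfolding dual_qnorm_def by (intro cSUP_upper) auto
  moreover have "(Z *v w) \<bullet> ?u = q"
    using q by (simp add: inner_commute q2[symmetric] power2_eq_square)
  ultimately show ?thesis using q by (simp add: q2[symmetric] power_mono)
qed simp

section \<open>Gradient domination and descent\<close>

text \<open>
Writing \<open>x - y = Z w\<close>, strong convexity bounds \<open>f x - f y\<close> below by a quadratic function of \<open>w\<close>, whose
minimum over all \<open>w\<close> is attained at \<open>w = - grad y / \<sigma>\<close>. This is the Polyak--Lojasiewicz inequality in
the \<open>Z\<close>-norm when \<open>x\<close> ranges over the feasible points.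
\<close>
lemma gradient_dominated:
  fixes Z :: "real^'n^'n" and A :: "real^'n^'m" and grad :: "real^'n \<Rightarrow> real^'n"
  assumes sym: "\<And>u v. (Z *v u) \<bullet> v = u \<bullet> (Z *v v)"
    and psd: "\<And>u. 0 \<le> u \<bullet> (Z *v u)"
    and range: "\<And>v. Z *v v \<in> ker A"
    and pd: "\<And>u. u \<in> ker A \<Longrightarrow> u \<noteq> 0 \<Longrightarrow> 0 < u \<bullet> (Z *v u)"
    and \<sigma>: "0 < \<sigma>"
    and h: "x - y \<in> ker A"
    and sc: "f y + grad y \<bullet> (x - y) + \<sigma>/2 * (dual_qnorm Z (x - y))\<^sup>2 \<le> f x"
  shows "f y - 1 / (2 * \<sigma>) * (grad y \<bullet> (Z *v grad y)) \<le> f x"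
proof -
  obtain w where w: "x - y = Z *v w" using ker_image_surjective[OF range pd] h by blast
  let ?g = "grad y"
  have "w \<bullet> (Z *v w) \<le> (dual_qnorm Z (x - y))\<^sup>2"
    unfolding w by (rule dual_qnorm_ge[OF sym psd])
  then have "\<sigma>/2 * (w \<bullet> (Z *v w)) \<le> \<sigma>/2 * (dual_qnorm Z (x - y))\<^sup>2"
    using \<sigma> by (intro mult_left_mono) auto
  then have 1: "f y + ?g \<bullet> (Z *v w) + \<sigma>/2 * (w \<bullet> (Z *v w)) \<le> f x" using sc w by simp
  \<comment> \<open>Completing the square around that minimiser.\<close>
  have "0 \<le> (?g + \<sigma> *\<^sub>R w) \<bullet> (Z *v (?g + \<sigma> *\<^sub>R w))" by (rule psd)
  also have "\<dots> = ?g \<bullet> (Z *v ?g) + 2 * \<sigma> * (?g \<bullet> (Z *v w)) + \<sigma>\<^sup>2 * (w \<bullet> (Z *v w))"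
    using sym[of w ?g]
    by (simp add: matrix_vector_right_distrib matrix_vector_mult_scaleR inner_add_left inner_add_right
        inner_commute power2_eq_square algebra_simps)
  finally have "0 \<le> (?g \<bullet> (Z *v ?g) + 2 * \<sigma> * (?g \<bullet> (Z *v w)) + \<sigma>\<^sup>2 * (w \<bullet> (Z *v w))) / (2 * \<sigma>)"
    using \<sigma> by simp
  also have "\<dots> = 1 / (2 * \<sigma>) * (?g \<bullet> (Z *v ?g)) + ?g \<bullet> (Z *v w) + \<sigma>/2 * (w \<bullet> (Z *v w))"
    using \<sigma> by (simp add: field_simps power2_eq_square)
  finally show ?thesis using 1 by linarith
qed

text \<open>
Both the linear and the quadratic term of the smoothness bound are multiples of \<open>g \<bullet> W g\<close>, with
coefficients \<open>-1\<close> and \<open>1/2\<close>.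
\<close>
lemma sketch_step_descent:
  fixes W M :: "real^'n^'n"
  assumes sym: "Finite_Cartesian_Product.transpose W = W" and idem: "W ** M ** W = W"
    and smooth: "f (x - W *v g) \<le> f x + g \<bullet> ((x - W *v g) - x)
      + 1/2 * (((x - W *v g) - x) \<bullet> (M *v ((x - W *v g) - x)))"
  shows "f (x - W *v g) \<le> f x - 1/2 * (g \<bullet> (W *v g))"
  using smooth sketch_quadratic_form[OF sym idem, of g]
  by (simp add: vec.neg)

lemma mem_affine_ker:
  "A *v x0 = b \<Longrightarrow> x \<in> (+) x0 ` ker A \<longleftrightarrow> A *v x = b"
  by (auto simp: ker_def matrix_vector_right_distrib matrix_vector_mult_diff_distrib
      intro!: image_eqI[of _ _ "x - x0"])

section \<open>Measurability and independence of the iterates\<close>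

lemma borel_measurable_differentiable:
  fixes f :: "'a::euclidean_space \<Rightarrow> real"
  assumes "\<And>x. GDERIV f x :> grad x"
  shows "f \<in> borel_measurable borel"
proof (intro borel_measurable_continuous_onI continuous_at_imp_continuous_on ballI)
  fix x show "isCont f x"
    using assms[of x] unfolding gderiv_def by (rule has_derivative_continuous)
qed

text \<open>
The gradient need not be continuous, but each of its components is a pointwise limit of difference
quotients of a continuous function.
\<close>
lemma borel_measurable_gradient:
  fixes f :: "'a::euclidean_space \<Rightarrow> real"
  assumes "\<And>x. GDERIV f x :> grad x"
  shows "grad \<in> borel_measurable borel"
proof (subst borel_measurable_euclidean_space, safe)
  fix i :: 'a assume "i \<in> Basis"
  have [measurable]: "f \<in> borel_measurable borel"
    using assms by (rule borel_measurable_differentiable)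
  show "(\<lambda>x. grad x \<bullet> i) \<in> borel_measurable borel"
  proof (rule borel_measurable_LIMSEQ_real)
    fix x
    have "(f has_derivative (\<lambda>h. h \<bullet> grad x)) (at x)" using assms[of x] by (simp add: gderiv_def)
    then have "(f has_derivative (\<lambda>h. h \<bullet> grad x)) (at (x + 0 *\<^sub>R i))" by simp
    moreover have "((\<lambda>t. x + t *\<^sub>R i) has_derivative (\<lambda>t. t *\<^sub>R i)) (at 0)"
      by (auto intro!: derivative_eq_intros)
    ultimately have "((\<lambda>t. f (x + t *\<^sub>R i)) has_derivative (\<lambda>t. (t *\<^sub>R i) \<bullet> grad x)) (at 0)"
      using has_derivative_compose by blast
    moreover have "(\<lambda>t. (t *\<^sub>R i) \<bullet> grad x) = (*) (grad x \<bullet> i)"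
      by (auto simp: inner_commute)
    ultimately have "((\<lambda>t. f (x + t *\<^sub>R i)) has_real_derivative grad x \<bullet> i) (at 0)"
      by (simp add: has_field_derivative_def)
    then have "((\<lambda>h. (f (x + h *\<^sub>R i) - f x) / h) \<longlongrightarrow> grad x \<bullet> i) (at 0)"
      by (simp add: has_field_derivative_iff)
    moreover have "filterlim (\<lambda>n. 1 / real (Suc n)) (at 0) sequentially"
      using LIMSEQ_inverse_real_of_nat by (auto simp: filterlim_at inverse_eq_divide)
    ultimately show "(\<lambda>n. (f (x + (1 / real (Suc n)) *\<^sub>R i) - f x) / (1 / real (Suc n))) \<longlonglongrightarrow> grad x \<bullet> i"
      by (rule filterlim_compose)
  qed measurable
qed

lemma borel_measurable_matrix_vector_mult:
  fixes F :: "'a \<Rightarrow> real^'n^'m"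
  assumes [measurable]: "F \<in> borel_measurable N" "v \<in> borel_measurable N"
  shows "(\<lambda>x. F x *v v x) \<in> borel_measurable N"
proof -
  have "(\<lambda>p. fst p *v snd p :: real^'m) \<in> borel_measurable (borel \<Otimes>\<^sub>M borel)"
    unfolding borel_prod
    by (intro borel_measurable_continuous_onI) (auto simp: matrix_vector_mult_def intro!: continuous_intros)
  from measurable_compose[OF _ this, of "\<lambda>x. (F x, v x)"] show ?thesis by simp
qed

lemma rsd_cong:
  "(\<And>j. j < k \<Longrightarrow> S j = S' j) \<Longrightarrow> rsd A M g x0 S k = rsd A M g x0 S' k"
  by (induction k) auto

text \<open>
The index set is a parameter so that an induction on the number of steps stays on one product space.
\<close>
lemma measurable_rsd:
  assumes [measurable]: "sketch_update A M \<in> borel_measurable \<D>" "g \<in> borel_measurable borel"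
    and "{..<k} \<subseteq> I"
  shows "(\<lambda>s. rsd A M g x0 s k) \<in> borel_measurable (PiM I (\<lambda>_. \<D>))"
  using assms(3)
proof (induction k)
  case (Suc k)
  then have "k \<in> I" and [measurable]: "(\<lambda>s. rsd A M g x0 s k) \<in> borel_measurable (PiM I (\<lambda>_. \<D>))" by (auto simp: lessThan_Suc)
  have [measurable]: "(\<lambda>s. s k) \<in> measurable (PiM I (\<lambda>_. \<D>)) \<D>"
    using \<open>k \<in> I\<close> by (rule measurable_component_singleton)
  show ?case
    by (simp, intro borel_measurable_diff borel_measurable_matrix_vector_mult) measurable
qed simp

lemma iid_samples_measurable:
  assumes "iid_samples \<P> \<D> S"
  shows "S k \<in> measurable \<P> \<D>"
proof -
  interpret P: prob_space \<P> using assms by (simp add: iid_samples_def)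
  show ?thesis using assms by (simp add: iid_samples_def P.indep_vars_def)
qed

text \<open>
The iterate is a function of the samples before step \<open>k\<close>, hence independent of the sample drawn at
step \<open>k\<close>.
\<close>
lemma rsd_sample_joint_distribution:
  fixes x0 :: "real^'n" and k :: nat
  assumes samples: "iid_samples \<P> \<D> S"
    and W: "sketch_update A M \<in> borel_measurable \<D>" and g: "g \<in> borel_measurable borel"
  defines "X \<equiv> \<lambda>\<omega>. rsd A M g x0 (\<lambda>j. S j \<omega>) k"
  shows "X \<in> borel_measurable \<P>"
    and "distr \<P> (borel \<Otimes>\<^sub>M \<D>) (\<lambda>\<omega>. (X \<omega>, S k \<omega>)) = distr \<P> borel X \<Otimes>\<^sub>M \<D>"
proof -
  interpret P: prob_space \<P> using samples by (simp add: iid_samples_def)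
  have ind: "P.indep_vars (\<lambda>_. \<D>) S UNIV" and dist: "distr \<P> \<D> (S k) = \<D>"
    using samples by (auto simp: iid_samples_def)
  have S [measurable]: "S k \<in> measurable \<P> \<D>" for k
    by (rule iid_samples_measurable[OF samples])
  \<comment> \<open>Independence of two random variables is stated for variables of the same type, so the fresh sample enters as a family over the index set \<open>{k}\<close>, and both laws are pushed forward only afterwards.\<close>
  let ?H = "\<lambda>\<omega>. restrict (\<lambda>i. S i \<omega>) {..<k}" and ?K = "\<lambda>\<omega>. restrict (\<lambda>i. S i \<omega>) {k}"
  let ?MH = "PiM {..<k} (\<lambda>_. \<D>)" and ?MK = "PiM {k} (\<lambda>_. \<D>)"
  let ?Y = "\<lambda>s. rsd A M g x0 s k"
  have Y [measurable]: "?Y \<in> borel_measurable ?MH" by (rule measurable_rsd[OF W g]) simp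
  have [measurable]: "?H \<in> measurable \<P> ?MH" "?K \<in> measurable \<P> ?MK" by (auto intro!: measurable_restrict)
  have [measurable]: "(\<lambda>s. s k) \<in> measurable ?MK \<D>" by (auto intro!: measurable_component_singleton)
  have X: "X = (\<lambda>\<omega>. ?Y (?H \<omega>))"
    by (auto simp: X_def fun_eq_iff intro!: rsd_cong)
  show [measurable]: "X \<in> borel_measurable \<P>" unfolding X by measurable
  have "P.indep_var ?MH ?H ?MK ?K"
    by (rule P.indep_var_restrict[OF ind]) auto
  then have HK: "distr \<P> ?MH ?H \<Otimes>\<^sub>M distr \<P> ?MK ?K = distr \<P> (?MH \<Otimes>\<^sub>M ?MK) (\<lambda>\<omega>. (?H \<omega>, ?K \<omega>))"
    by (simp add: P.indep_var_distribution_eq)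
  have X': "distr \<P> borel X = distr (distr \<P> ?MH ?H) borel ?Y"
    unfolding X by (subst distr_distr) (auto simp: comp_def)
  have D': "\<D> = distr (distr \<P> ?MK ?K) \<D> (\<lambda>s. s k)"
    by (subst distr_distr) (auto simp: comp_def dist)
  interpret D: prob_space \<D> using P.prob_space_distr[OF S[of k]] by (simp add: dist)
  have sf: "sigma_finite_measure (distr (distr \<P> ?MK ?K) \<D> (\<lambda>s. s k))"
    using D'[symmetric] D.sigma_finite_measure_axioms by simp
  have "distr \<P> borel X \<Otimes>\<^sub>M \<D> = distr (distr \<P> ?MH ?H) borel ?Y \<Otimes>\<^sub>M distr (distr \<P> ?MK ?K) \<D> (\<lambda>s. s k)"
    using X' D' by simp
  also have "\<dots> = distr (distr \<P> ?MH ?H \<Otimes>\<^sub>M distr \<P> ?MK ?K) (borel \<Otimes>\<^sub>M \<D>) (\<lambda>(a, c). (?Y a, c k))"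
    by (rule pair_measure_distr[OF _ _ sf]) auto
  also have "\<dots> = distr \<P> (borel \<Otimes>\<^sub>M \<D>) (\<lambda>\<omega>. (X \<omega>, S k \<omega>))"
    unfolding HK X by (subst distr_distr) (auto simp: comp_def)
  finally show "distr \<P> (borel \<Otimes>\<^sub>M \<D>) (\<lambda>\<omega>. (X \<omega>, S k \<omega>)) = distr \<P> borel X \<Otimes>\<^sub>M \<D>" by simp
qed

text \<open>
Fubini's theorem for the product law of the iterate and the fresh sample, in the form of a conditional
expectation: the sample is integrated out while the iterate is held fixed.
\<close>
lemma integral_over_fresh_sample:
  fixes h :: "(real^'n) \<times> real mat \<Rightarrow> real" and x0 :: "real^'n" and k :: nat
  assumes samples: "iid_samples \<P> \<D> S"
    and W: "sketch_update A M \<in> borel_measurable \<D>" and g: "g \<in> borel_measurable borel"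
    and h [measurable]: "h \<in> borel_measurable (borel \<Otimes>\<^sub>M \<D>)"
  defines "X \<equiv> \<lambda>\<omega>. rsd A M g x0 (\<lambda>j. S j \<omega>) k"
  assumes int: "integrable \<P> (\<lambda>\<omega>. h (X \<omega>, S k \<omega>))"
  shows "integrable \<P> (\<lambda>\<omega>. \<integral>s. h (X \<omega>, s) \<partial>\<D>)"
    and "(\<integral>\<omega>. h (X \<omega>, S k \<omega>) \<partial>\<P>) = (\<integral>\<omega>. (\<integral>s. h (X \<omega>, s) \<partial>\<D>) \<partial>\<P>)"
proof -
  interpret P: prob_space \<P> using samples by (simp add: iid_samples_def)
  have [measurable]: "X \<in> borel_measurable \<P>"
    unfolding X_def by (rule rsd_sample_joint_distribution[OF samples W g])
  have joint: "distr \<P> (borel \<Otimes>\<^sub>M \<D>) (\<lambda>\<omega>. (X \<omega>, S k \<omega>)) = distr \<P> borel X \<Otimes>\<^sub>M \<D>"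
    unfolding X_def by (rule rsd_sample_joint_distribution[OF samples W g])
  have S [measurable]: "S k \<in> measurable \<P> \<D>" by (rule iid_samples_measurable[OF samples])
  interpret D: prob_space \<D>
    using P.prob_space_distr[OF S] samples by (simp add: iid_samples_def)
  interpret X: prob_space "distr \<P> borel X" by (rule P.prob_space_distr) measurable
  interpret XD: pair_sigma_finite "distr \<P> borel X" \<D> ..
  have "integrable (distr \<P> (borel \<Otimes>\<^sub>M \<D>) (\<lambda>\<omega>. (X \<omega>, S k \<omega>))) h"
    using int by (subst integrable_distr_eq) auto
  then have int': "integrable (distr \<P> borel X \<Otimes>\<^sub>M \<D>) h" by (simp add: joint)
  have inner [measurable]: "(\<lambda>x. \<integral>s. h (x, s) \<partial>\<D>) \<in> borel_measurable borel"
    by measurable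
  show "integrable \<P> (\<lambda>\<omega>. \<integral>s. h (X \<omega>, s) \<partial>\<D>)"
    using XD.integrable_fst'[OF int'] by (subst (asm) integrable_distr_eq) auto
  have "(\<integral>\<omega>. h (X \<omega>, S k \<omega>) \<partial>\<P>) = (\<integral>p. h p \<partial>(distr \<P> borel X \<Otimes>\<^sub>M \<D>))"
    unfolding joint[symmetric] by (subst integral_distr) auto
  also have "\<dots> = (\<integral>x. (\<integral>s. h (x, s) \<partial>\<D>) \<partial>(distr \<P> borel X))"
    by (rule XD.integral_fst'[OF int', symmetric])
  also have "\<dots> = (\<integral>\<omega>. (\<integral>s. h (X \<omega>, s) \<partial>\<D>) \<partial>\<P>)"
    by (subst integral_distr) auto
  finally show "(\<integral>\<omega>. h (X \<omega>, S k \<omega>) \<partial>\<P>) = (\<integral>\<omega>. (\<integral>s. h (X \<omega>, s) \<partial>\<D>) \<partial>\<P>)" .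
qed

section \<open>The convergence rate\<close>

text \<open>
Multiplication by \<open>1 - \<sigma>\<close> is monotone only if \<open>\<sigma> \<le> 1\<close>; for larger \<open>\<sigma>\<close> the step inequality and
nonnegativity leave no room, and \<open>e\<close> vanishes identically.
\<close>
lemma linear_rate_from_step:
  fixes e :: "nat \<Rightarrow> real"
  assumes nonneg: "\<And>k. 0 \<le> e k" and step: "\<And>k. e (Suc k) \<le> (1 - \<sigma>) * e k"
  shows "e k \<le> (1 - \<sigma>) ^ k * e 0"
proof (cases "\<sigma> \<le> 1")
  case True
  show ?thesis
  proof (induction k)
    case (Suc k)
    have "e (Suc k) \<le> (1 - \<sigma>) * e k" by (rule step)
    also have "\<dots> \<le> (1 - \<sigma>) * ((1 - \<sigma>) ^ k * e 0)" using Suc True by (intro mult_left_mono) auto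
    finally show ?case by simp
  qed simp
next
  case False
  have "e k = 0" for k
  proof (rule ccontr)
    assume "e k \<noteq> 0"
    then have "(1 - \<sigma>) * e k < 0" using nonneg[of k] False by (intro mult_neg_pos) auto
    then show False using step[of k] nonneg[of "Suc k"] by linarith
  qed
  then show ?thesis by simp
qed

theorem theorem3p5:
  fixes f :: "real^'n \<Rightarrow> real"
    and grad :: "real^'n \<Rightarrow> real^'n"
    and A :: "real^'n^'m"
    and b :: "real^'m"
    and x0 :: "real^'n"
    and M Z :: "real^'n^'n"
    and \<D> :: "real mat measure"
    and \<P> :: "'w measure"
    and S :: "nat \<Rightarrow> 'w \<Rightarrow> real mat"
    and \<sigma> :: real
    and k :: nat
  assumes dims: "CARD('m) < CARD('n)"
    and gradient: "\<And>x. GDERIV f x :> grad x"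
    and feasible: "A *v x0 = b"
    and M_symmetric: "Finite_Cartesian_Product.transpose M = M"
    and M_psd: "\<And>u. 0 \<le> u \<bullet> (M *v u)"
    and M_pd_ker: "\<And>u. u \<in> ker A \<Longrightarrow> u \<noteq> 0 \<Longrightarrow> 0 < u \<bullet> (M *v u)"
    and smooth: "\<And>x y. x \<in> (+) x0 ` ker A \<Longrightarrow> y \<in> (+) x0 ` ker A \<Longrightarrow>
        f y \<le> f x + grad x \<bullet> (y - x) + 1/2 * ((y - x) \<bullet> (M *v (y - x)))"
    and distribution: "sketch_distribution CARD('n) \<D>"
    and finite_mean: "integrable \<D> (sketch_update A M)"
    and Z_def: "Z = (\<integral>S. sketch_update A M S \<partial>\<D>)"
    and Z_pd_ker: "\<And>u. u \<in> ker A \<Longrightarrow> u \<noteq> 0 \<Longrightarrow> 0 < u \<bullet> (Z *v u)"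
    and \<sigma>_pos: "0 < \<sigma>"
    and strongly_convex: "\<And>x y. x \<in> (+) x0 ` ker A \<Longrightarrow> y \<in> (+) x0 ` ker A \<Longrightarrow>
        f y + grad y \<bullet> (x - y) + \<sigma>/2 * (dual_qnorm Z (x - y))\<^sup>2 \<le> f x"
    and samples: "iid_samples \<P> \<D> S"
  shows "integrable \<P> (\<lambda>\<omega>. f (rsd A M grad x0 (\<lambda>j. S j \<omega>) k)) \<and>
    (\<integral>\<omega>. f (rsd A M grad x0 (\<lambda>j. S j \<omega>) k) \<partial>\<P>) - opt_value f A b
      \<le> (1 - \<sigma>) ^ k * (f x0 - opt_value f A b)"
proof -
  let ?W = "sketch_update A M"
  define X where "X k \<omega> = rsd A M grad x0 (\<lambda>j. S j \<omega>) k" for k \<omega>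
  define fs where "fs = opt_value f A b"
  interpret D: prob_space \<D> using distribution by (simp add: sketch_distribution_def)
  interpret P: prob_space \<P> using samples by (simp add: iid_samples_def)
  have rows: "dim_row s = CARD('n)" if "s \<in> space \<D>" for s
    using distribution that by (auto simp: sketch_distribution_def)
  note W = sketch_update_properties[OF rows M_symmetric, where A=A]
  have W_meas [measurable]: "?W \<in> borel_measurable \<D>" using finite_mean by simp
  have grad_meas [measurable]: "grad \<in> borel_measurable borel" using gradient by (rule borel_measurable_gradient)
  have f_meas [measurable]: "f \<in> borel_measurable borel"
    using gradient by (rule borel_measurable_differentiable)
  have W_psd: "0 \<le> u \<bullet> (?W s *v u)" if "s \<in> space \<D>" for s u
    using sketch_quadratic_form[OF W(1,2)[OF that], of u] M_psd by metis
  have AW: "A *v (?W s *v u) = 0" if "s \<in> space \<D>" for s u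
    using W(3)[OF that] by (simp add: matrix_vector_mul_assoc)
  have Z_form: "u \<bullet> (Z *v v) = (\<integral>s. u \<bullet> (?W s *v v) \<partial>\<D>)" for u v
    unfolding Z_def by (rule integral_matrix_form[OF finite_mean, symmetric])
  have W_int: "integrable \<D> (\<lambda>s. u \<bullet> (?W s *v v))" for u v
    by (rule integrable_bounded_linear[OF bounded_linear_matrix_form finite_mean])
  \<comment> \<open>Symmetry, semidefiniteness and the range of \<open>Z\<close> are inherited from the update matrices.\<close>
  have Z_sym: "(Z *v u) \<bullet> v = u \<bullet> (Z *v v)" for u v
  proof -
    have "(\<integral>s. v \<bullet> (?W s *v u) \<partial>\<D>) = (\<integral>s. u \<bullet> (?W s *v v) \<partial>\<D>)"
      using symmetric_inner_matrix[OF W(1), of _ u v]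
      by (intro Bochner_Integration.integral_cong) (simp_all add: inner_commute)
    then show ?thesis by (simp add: Z_form inner_commute[of "Z *v u"])
  qed
  have Z_psd: "0 \<le> u \<bullet> (Z *v u)" for u
    unfolding Z_form by (intro integral_nonneg_AE AE_I2 W_psd)
  have Z_range: "Z *v v \<in> ker A" for v
  proof -
    have "u \<bullet> (A *v (Z *v v)) = 0" for u
    proof -
      have "u \<bullet> (A *v (Z *v v)) = (\<integral>s. (u v* A) \<bullet> (?W s *v v) \<partial>\<D>)"
        unfolding Z_form[symmetric] by (rule dot_lmul_matrix[symmetric])
      also have "\<dots> = (\<integral>s. 0 \<partial>\<D>)"
        by (intro Bochner_Integration.integral_cong) (simp_all add: dot_lmul_matrix AW)
      finally show ?thesis by simp
    qed
    from this[of "A *v (Z *v v)"] show ?thesis by (simp add: ker_def)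
  qed
  note feas = mem_affine_ker[OF feasible]
  \<comment> \<open>The lower bound below also shows that the infimum defining the optimal value is over a set bounded below.\<close>
  have dominated: "f y - 1 / (2 * \<sigma>) * (grad y \<bullet> (Z *v grad y)) \<le> f x"
    if "A *v x = b" "A *v y = b" for x y
  proof -
    have "x \<in> (+) x0 ` ker A" "y \<in> (+) x0 ` ker A" using that by (simp_all add: feas)
    moreover have "x - y \<in> ker A" using that by (simp add: ker_def matrix_vector_mult_diff_distrib)
    ultimately show ?thesis
      by (intro gradient_dominated[OF Z_sym Z_psd Z_range Z_pd_ker \<sigma>_pos _ strongly_convex])
  qed
  have fs_le: "fs \<le> f x" if "A *v x = b" for x
    unfolding fs_def opt_value_def
    using that dominated[OF _ feasible] by (intro cINF_lower bdd_belowI2) auto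
  have gap: "\<sigma> * (f y - fs) \<le> 1/2 * (grad y \<bullet> (Z *v grad y))" if "A *v y = b" for y
  proof -
    have "f y - 1 / (2 * \<sigma>) * (grad y \<bullet> (Z *v grad y)) \<le> fs"
      unfolding fs_def opt_value_def using feasible dominated[OF _ that] by (intro cINF_greatest) auto
    then show ?thesis using \<sigma>_pos by (simp add: field_simps)
  qed
  let ?h = "\<lambda>p. f (fst p - ?W (snd p) *v grad (fst p))"
  have h_meas [measurable]: "?h \<in> borel_measurable (borel \<Otimes>\<^sub>M \<D>)"
    by (intro measurable_compose[OF _ f_meas] borel_measurable_diff borel_measurable_matrix_vector_mult) measurable
  have next_feas: "A *v (y - ?W s *v v) = b" if "A *v y = b" "s \<in> space \<D>" for y s v
    using that AW by (simp add: matrix_vector_mult_diff_distrib)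
  have h_le: "?h (y, s) \<le> f y - 1/2 * (grad y \<bullet> (?W s *v grad y))"
    if "A *v y = b" "s \<in> space \<D>" for y s
  proof -
    have "y \<in> (+) x0 ` ker A" "y - ?W s *v grad y \<in> (+) x0 ` ker A"
      using that next_feas by (simp_all add: feas)
    from sketch_step_descent[OF W(1,2)[OF that(2)] smooth[OF this]] show ?thesis by simp
  qed
  have h_le': "?h (y, s) \<le> f y" if "A *v y = b" "s \<in> space \<D>" for y s
    using h_le[OF that] W_psd[OF that(2), of "grad y"] by simp
  have h_ge: "fs \<le> ?h (y, s)" if "A *v y = b" "s \<in> space \<D>" for y s
    using fs_le[OF next_feas[OF that]] by simp
  have step: "(\<integral>s. ?h (y, s) \<partial>\<D>) \<le> fs + (1 - \<sigma>) * (f y - fs)" if y: "A *v y = b" for y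
  proof -
    have "(\<lambda>s. ?h (y, s)) \<in> borel_measurable \<D>"
      by (rule measurable_Pair2[OF h_meas]) simp
    moreover have "\<bar>?h (y, s)\<bar> \<le> \<bar>f y\<bar> + \<bar>fs\<bar>" if "s \<in> space \<D>" for s
      using h_le'[OF y that] h_ge[OF y that] by linarith
    ultimately have "integrable \<D> (\<lambda>s. ?h (y, s))"
      by (intro D.integrable_const_bound[where B="\<bar>f y\<bar> + \<bar>fs\<bar>"] AE_I2) simp_all
    then have "(\<integral>s. ?h (y, s) \<partial>\<D>) \<le> (\<integral>s. f y - 1/2 * (grad y \<bullet> (?W s *v grad y)) \<partial>\<D>)"
      using W_int h_le[OF y] by (intro integral_mono) auto
    also have "\<dots> = f y - 1/2 * (grad y \<bullet> (Z *v grad y))"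
      using W_int by (simp add: Z_form D.prob_space)
    finally show ?thesis using gap[OF y] by (simp add: algebra_simps)
  qed
  have S_space: "S k \<omega> \<in> space \<D>" if "\<omega> \<in> space \<P>" for k \<omega>
    using measurable_space[OF iid_samples_measurable[OF samples] that] .
  have X_Suc: "f (X (Suc k) \<omega>) = ?h (X k \<omega>, S k \<omega>)" for k \<omega> by (simp add: X_def)
  have X_feas: "A *v X k \<omega> = b" if "\<omega> \<in> space \<P>" for k \<omega>
    by (induction k) (use that S_space feasible next_feas in \<open>auto simp: X_def\<close>)
  have X_le: "f (X k \<omega>) \<le> f x0" if "\<omega> \<in> space \<P>" for k \<omega>
  proof (induction k)
    case (Suc k)
    then show ?case using h_le'[OF X_feas[OF that, of k] S_space[OF that, of k]] X_Suc[of k \<omega>] by linarith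
  qed (simp add: X_def)
  have X_meas [measurable]: "X k \<in> borel_measurable \<P>" for k
    unfolding X_def by (rule rsd_sample_joint_distribution[OF samples W_meas grad_meas])
  have int: "integrable \<P> (\<lambda>\<omega>. f (X k \<omega>))" for k
  proof (intro P.integrable_const_bound[where B="\<bar>f x0\<bar> + \<bar>fs\<bar>"] AE_I2)
    fix \<omega> assume "\<omega> \<in> space \<P>"
    then show "norm (f (X k \<omega>)) \<le> \<bar>f x0\<bar> + \<bar>fs\<bar>"
      using X_le[of \<omega> k] fs_le[OF X_feas[of \<omega> k]] by simp
  qed measurable
  define e where "e k = (\<integral>\<omega>. f (X k \<omega>) \<partial>\<P>) - fs" for k
  have "e (Suc k) \<le> (1 - \<sigma>) * e k" for k
  proof -
    note fresh = integral_over_fresh_sample[OF samples W_meas grad_meas h_meas,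
        of x0 k, folded X_def, folded X_Suc, OF int]
    have "(\<integral>\<omega>. f (X (Suc k) \<omega>) \<partial>\<P>) = (\<integral>\<omega>. (\<integral>s. ?h (X k \<omega>, s) \<partial>\<D>) \<partial>\<P>)"
      by (rule fresh(2))
    also have "\<dots> \<le> (\<integral>\<omega>. fs + (1 - \<sigma>) * (f (X k \<omega>) - fs) \<partial>\<P>)"
      using fresh(1) int step X_feas by (intro integral_mono) auto
    also have "\<dots> = fs + (1 - \<sigma>) * e k"
      using int by (simp add: e_def P.prob_space)
    finally show ?thesis by (simp add: e_def)
  qed
  moreover have "0 \<le> e k" for k
  proof -
    have "(\<integral>\<omega>. fs \<partial>\<P>) \<le> (\<integral>\<omega>. f (X k \<omega>) \<partial>\<P>)"
      using int fs_le X_feas by (intro integral_mono) auto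
    then show ?thesis by (simp add: e_def P.prob_space)
  qed
  ultimately have "e k \<le> (1 - \<sigma>) ^ k * e 0" by (intro linear_rate_from_step)
  moreover have "e 0 = f x0 - fs" by (simp add: e_def X_def P.prob_space)
  ultimately show ?thesis using int[of k] by (simp add: e_def X_def fs_def P.prob_space)
qed

end
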